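(* Let $\mathscr{H}$ be a complex Hilbert space and let $B,C$ be bounded linear operators on $\mathscr{H}$. Then $$\frac{1}{2} w(B^2+C^2)+\frac{1}{2}\max \{w(B),w(C)\}\,\big| w(B+C)-w(B-C)\big| \;\leq\; w_e^2(B,C)$$ and $$w_e^2(B,C)\;\leq\; \min \left \{ w(|B|+i|C|)\,w(|B^*|+i|C^*|),\; w(|B|+i|C^*|)\,w(|B^*|+i|C|) \right \}.$$
   Context: For a bounded linear operator $A$ on a complex Hilbert space $\mathscr{H}$ with inner product $\langle\cdot,\cdot\rangle$: $A^*$ is the adjoint, $|A|=(A^*A)^{1/2}$ is the positive square root, and the numerical radius is $w(A)=\sup\{|\langle Ax,x\rangle| : x\in\mathscr{H}, \|x\|=1\}$. The Euclidean operator radius of a pair of bounded linear operators $B,C$ is $w_e(B,C)=\sup\{\sqrt{|\langle Bx,x\rangle|^2+|\langle Cx,x\rangle|^2} : x\in\mathscr{H}, \|x\|=1\}$, and $w_e^2(B,C)$ denotes $(w_e(B,C))^2$. *)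

theory Defs
  imports "HOL-Analysis.Analysis"
begin

text \<open>
  A complex inner product space is presented on top of the library's real inner product spaces:
  the complex inner product (linear in the first argument) has the real one as its real part.
  Positive definiteness and the formula for the norm are thereby inherited from \<^class>\<open>real_inner\<close>.
\<close>

class complex_inner = real_inner +
  fixes scaleC :: "complex \<Rightarrow> 'a \<Rightarrow> 'a"  (infixr \<open>*\<^sub>C\<close> 75)
    and cinner :: "'a \<Rightarrow> 'a \<Rightarrow> complex"
  assumes scaleC_add_right: "c *\<^sub>C (x + y) = c *\<^sub>C x + c *\<^sub>C y"
    and scaleC_add_left: "(c + d) *\<^sub>C x = c *\<^sub>C x + d *\<^sub>C x"
    and scaleC_scaleC: "c *\<^sub>C (d *\<^sub>C x) = (c * d) *\<^sub>C x"
    and scaleC_complex_of_real: "complex_of_real r *\<^sub>C x = r *\<^sub>R x"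
    and cinner_commute: "cinner x y = cnj (cinner y x)"
    and cinner_add_left: "cinner (x + y) z = cinner x z + cinner y z"
    and cinner_scaleC_left: "cinner (c *\<^sub>C x) y = c * cinner x y"
    and Re_cinner: "Re (cinner x y) = inner x y"

class chilbert_space = complex_inner + complete_space

instantiation complex :: chilbert_space
begin

definition scaleC_complex :: "complex \<Rightarrow> complex \<Rightarrow> complex"
  where "scaleC_complex c x = c * x"

definition cinner_complex :: "complex \<Rightarrow> complex \<Rightarrow> complex"
  where "cinner_complex x y = x * cnj y"

instance
  by standard
    (simp_all add: scaleC_complex_def cinner_complex_def inner_complex_def algebra_simps
      scaleR_conv_of_real)

end

lemma cinner_self: "cinner x x = complex_of_real ((norm x)\<^sup>2)"
  for x :: "'a::complex_inner"
proof -
  have "Im (cinner x x) = 0"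
    using cinner_commute[of x x] by (metis Reals_cnj_iff complex_is_Real_iff)
  then show ?thesis
    by (simp add: complex_eq_iff Re_cinner power2_norm_eq_inner)
qed

definition bounded_clinear :: "('a::complex_inner \<Rightarrow> 'a) \<Rightarrow> bool"
  where "bounded_clinear A \<longleftrightarrow> bounded_linear A \<and> (\<forall>c x. A (c *\<^sub>C x) = c *\<^sub>C A x)"

text \<open>
  The descriptions in the adjoint and in the absolute value have unique solutions for bounded
  operators on a Hilbert space; other arguments are not intended.
\<close>

definition cadjoint :: "('a::chilbert_space \<Rightarrow> 'a) \<Rightarrow> 'a \<Rightarrow> 'a"
  where "cadjoint A = (THE A'. \<forall>x y. cinner (A x) y = cinner x (A' y))"

definition positive_op :: "('a::complex_inner \<Rightarrow> 'a) \<Rightarrow> bool"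
  where "positive_op P \<longleftrightarrow> bounded_clinear P \<and> (\<forall>x. cinner (P x) x \<in> \<real>\<^sub>\<ge>\<^sub>0)"

definition abs_op :: "('a::chilbert_space \<Rightarrow> 'a) \<Rightarrow> 'a \<Rightarrow> 'a"
  where "abs_op A = (THE P. positive_op P \<and> P \<circ> P = cadjoint A \<circ> A)"

text \<open>
  The supremum over unit vectors of a nonnegative function is taken in \<open>[0, \<infinity>)\<close>. In the zero space
  there are no unit vectors and this supremum is \<open>0\<close>, whereas \<open>Sup {}\<close> is unspecified
  for \<^typ>\<open>real\<close>.
\<close>

definition sup_unit :: "('a::real_normed_vector \<Rightarrow> real) \<Rightarrow> real"
  where "sup_unit f = (if \<exists>x::'a. norm x = 1 then SUP x\<in>{x. norm x = 1}. f x else 0)"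

definition numerical_radius :: "('a::complex_inner \<Rightarrow> 'a) \<Rightarrow> real"
  where "numerical_radius A = sup_unit (\<lambda>x. cmod (cinner (A x) x))"

definition euclidean_radius :: "('a::complex_inner \<Rightarrow> 'a) \<Rightarrow> ('a \<Rightarrow> 'a) \<Rightarrow> real"
  where "euclidean_radius B C =
    sup_unit (\<lambda>x. sqrt ((cmod (cinner (B x) x))\<^sup>2 + (cmod (cinner (C x) x))\<^sup>2))"

end

theory Submission
  imports Defs
begin

text \<open>
  Lower bound: pointwise \<open>|\<langle>(B \<plusminus> C) x, x\<rangle>|\<^sup>2 \<le> 2 (|\<langle>Bx, x\<rangle>|\<^sup>2 + |\<langle>Cx, x\<rangle>|\<^sup>2)\<close>, so with
  \<open>p = w(B + C)\<close> and \<open>q = w(B - C)\<close> we get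
  \<open>w\<^sub>e\<^sup>2 \<ge> max(p\<^sup>2, q\<^sup>2) / 2 = (p\<^sup>2 + q\<^sup>2) / 4 + (p + q) |p - q| / 4\<close>.
  Here \<open>p + q \<ge> 2 max(w(B), w(C))\<close>, and \<open>p\<^sup>2 + q\<^sup>2 \<ge> 2 w(B\<^sup>2 + C\<^sup>2)\<close> by the power inequality
  \<open>w(A\<^sup>2) \<le> w(A)\<^sup>2\<close>. Upper bound: the mixed Schwarz inequality
  \<open>|\<langle>Ax, x\<rangle>|\<^sup>2 \<le> \<langle>|A|x, x\<rangle> \<langle>|A\<^sup>*|x, x\<rangle>\<close> for \<open>B\<close> and \<open>C\<close>, the Cauchy-Schwarz inequality in
  \<open>\<real>\<^sup>2\<close>, and \<open>\<langle>Px, x\<rangle>\<^sup>2 + \<langle>Qx, x\<rangle>\<^sup>2 = |\<langle>(P + iQ) x, x\<rangle>|\<^sup>2\<close> for positive \<open>P\<close>, \<open>Q\<close>.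
\<close>

section \<open>Projections and adjoints in real Hilbert spaces\<close>

text \<open>A sequence minimizing the distance from \<open>x\<close> is Cauchy by the parallelogram
  law. Its limit \<open>l\<close> is a nearest point, and a nonzero \<open>inner (x - l) z\<close>
  would give a closer one in direction \<open>z\<close>.\<close>

lemma orthogonal_projection_exists:
  fixes S :: "'a::{real_inner, complete_space} set"
  assumes S: "subspace S" "closed S"
  shows "\<exists>y\<in>S. \<forall>z\<in>S. inner (x - y) z = 0"
proof -
  define d where "d = Inf ((\<lambda>y. (norm (x - y))\<^sup>2) ` S)"
  have ne: "S \<noteq> {}"
    using S(1) subspace_0 by blast
  have bdd: "bdd_below ((\<lambda>y. (norm (x - y))\<^sup>2) ` S)"
    by (rule bdd_belowI2[where m = 0]) simp
  have d_le: "d \<le> (norm (x - y))\<^sup>2" if "y \<in> S" for y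
    unfolding d_def using that bdd by (rule cINF_lower[rotated])
  have "\<exists>y\<in>S. (norm (x - y))\<^sup>2 < d + e" if "e > 0" for e
  proof -
    have "Inf ((\<lambda>y. (norm (x - y))\<^sup>2) ` S) < d + e"
      using that by (simp add: d_def)
    then show ?thesis
      using cINF_less_iff[OF ne bdd] by blast
  qed
  then have "\<exists>y\<in>S. (norm (x - y))\<^sup>2 < d + inverse (real (Suc n))" for n
    by simp
  then obtain y where yS: "\<And>n. y n \<in> S"
    and y: "\<And>n. (norm (x - y n))\<^sup>2 < d + inverse (real (Suc n))"
    by metis
  \<comment> \<open>Parallelogram law for \<open>x - y m\<close> and \<open>x - y n\<close>: the
    midpoint of \<open>y m\<close> and \<open>y n\<close> lies in \<open>S\<close>, so its squared
    distance from \<open>x\<close> is at least \<open>d\<close>.\<close>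
  have par: "(norm (y m - y n))\<^sup>2 \<le> 2 * (inverse (real (Suc m)) + inverse (real (Suc n)))" for m n
  proof -
    have "(1/2) *\<^sub>R (y m + y n) \<in> S"
      using S(1) yS by (simp add: subspace_add subspace_scale)
    then have "d \<le> (norm (x - (1/2) *\<^sub>R (y m + y n)))\<^sup>2"
      by (rule d_le)
    moreover have "(norm (y m - y n))\<^sup>2 + 4 * (norm (x - (1/2) *\<^sub>R (y m + y n)))\<^sup>2
        = 2 * (norm (x - y m))\<^sup>2 + 2 * (norm (x - y n))\<^sup>2"
      unfolding power2_norm_eq_inner
      by (simp add: inner_diff_left inner_diff_right inner_add_left inner_add_right
          inner_commute field_simps)
    ultimately show ?thesis
      using y[of m] y[of n] by (simp add: algebra_simps)
  qed
  have "Cauchy y"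
  proof (rule metric_CauchyI)
    fix e :: real assume "e > 0"
    then obtain N where N: "inverse (real (Suc N)) < e\<^sup>2 / 4"
      using reals_Archimedean[of "e\<^sup>2 / 4"] by auto
    have "dist (y m) (y n) < e" if "m \<ge> N" "n \<ge> N" for m n
    proof -
      have "(norm (y m - y n))\<^sup>2 \<le> 2 * (inverse (real (Suc m)) + inverse (real (Suc n)))"
        by (rule par)
      also have "\<dots> \<le> 2 * (inverse (real (Suc N)) + inverse (real (Suc N)))"
        using that by (intro mult_left_mono add_mono) simp_all
      also have "\<dots> < e\<^sup>2"
        using N by (simp del: of_nat_Suc)
      finally show ?thesis
        using \<open>e > 0\<close> by (simp add: dist_norm power2_less_imp_less)
    qed
    then show "\<exists>M. \<forall>m\<ge>M. \<forall>n\<ge>M. dist (y m) (y n) < e"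
      by blast
  qed
  then obtain l where l: "y \<longlonglongrightarrow> l"
    using Cauchy_convergent convergent_def by blast
  have lS: "l \<in> S"
    using S(2) yS l by (metis closed_sequentially)
  have "(\<lambda>n. (norm (x - y n))\<^sup>2) \<longlonglongrightarrow> (norm (x - l))\<^sup>2"
    by (intro tendsto_intros l)
  moreover have "(\<lambda>n. d + inverse (real (Suc n))) \<longlonglongrightarrow> d + 0"
    by (intro tendsto_intros LIMSEQ_inverse_real_of_nat)
  ultimately have ld: "(norm (x - l))\<^sup>2 \<le> d"
    using y by (metis (no_types, lifting) LIMSEQ_le add.right_neutral less_imp_le)
  have "inner (x - l) z = 0" if z: "z \<in> S" for z
  proof (rule ccontr)
    assume nz: "inner (x - l) z \<noteq> 0"
    define b where "b = inner z z"
    define r where "r = inner (x - l) z"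
    have b: "b > 0"
      using nz by (auto simp: b_def)
    \<comment> \<open>The coefficient \<open>r / b\<close> minimizes the distance along
      \<open>z\<close> and lowers its square by \<open>r^2 / b\<close>.\<close>
    have "l + (r / b) *\<^sub>R z \<in> S"
      using S(1) lS z by (simp add: subspace_add subspace_scale)
    then have "(norm (x - l))\<^sup>2 \<le> (norm (x - (l + (r / b) *\<^sub>R z)))\<^sup>2"
      by (rule order_trans[OF ld d_le])
    also have "x - (l + (r / b) *\<^sub>R z) = (x - l) - (r / b) *\<^sub>R z"
      by simp
    also have "(norm \<dots>)\<^sup>2 = (norm (x - l))\<^sup>2 - 2 * (r / b) * r + (r / b)\<^sup>2 * b"
    proof -
      have "(norm (u - c *\<^sub>R z))\<^sup>2 = (norm u)\<^sup>2 - 2 * c * inner u z + c\<^sup>2 * inner z z"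
        for u :: 'a and c
        unfolding power2_norm_eq_inner
        by (simp add: inner_diff_left inner_diff_right inner_commute[of z u]
            power2_eq_square algebra_simps)
      then show ?thesis
        unfolding r_def b_def .
    qed
    also have "\<dots> = (norm (x - l))\<^sup>2 - r\<^sup>2 / b"
      using b by (simp add: field_simps power2_eq_square)
    finally have "r\<^sup>2 / b \<le> 0"
      by simp
    then show False
      using b nz by (simp add: r_def divide_le_0_iff)
  qed
  with lS show ?thesis
    by blast
qed

lemma subspace_closure:
  fixes S :: "'a::real_normed_vector set"
  assumes "subspace S"
  shows "subspace (closure S)"
proof (rule subspaceI)
  show "0 \<in> closure S"
    using assms closure_subset subspace_0 by blast
next
  fix x y assume "x \<in> closure S" "y \<in> closure S"
  then obtain f g where "\<And>n. f n \<in> S" "f \<longlonglongrightarrow> x" "\<And>n. g n \<in> S" "g \<longlonglongrightarrow> y"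
    unfolding closure_sequential by blast
  then show "x + y \<in> closure S"
    unfolding closure_sequential using assms
    by (intro exI[of _ "\<lambda>n. f n + g n"]) (auto intro: tendsto_add subspace_add)
next
  fix c x assume "x \<in> closure S"
  then obtain f where "\<And>n. f n \<in> S" "f \<longlonglongrightarrow> x"
    unfolding closure_sequential by blast
  then show "c *\<^sub>R x \<in> closure S"
    unfolding closure_sequential using assms
    by (intro exI[of _ "\<lambda>n. c *\<^sub>R f n"]) (auto intro: tendsto_scaleR subspace_scale)
qed

text \<open>Subtracting from some \<open>a\<close> with \<open>f a \<noteq> 0\<close> its projection
  onto the kernel leaves a vector \<open>e\<close> normal to the kernel. Each
  \<open>x - (f x / f e) e\<close> lies in the kernel, and its orthogonality to \<open>e\<close>
  determines \<open>f x\<close>.\<close>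

lemma riesz_representation:
  fixes f :: "'a::{real_inner, complete_space} \<Rightarrow> real"
  assumes f: "bounded_linear f"
  shows "\<exists>y. \<forall>x. f x = inner x y"
proof (cases "\<forall>x. f x = 0")
  case True
  then show ?thesis
    by (intro exI[of _ 0]) simp
next
  case False
  interpret bounded_linear f by fact
  obtain a where a: "f a \<noteq> 0"
    using False by blast
  define S where "S = {x. f x = 0}"
  have "subspace S"
    by (simp add: S_def subspace_def zero add scale)
  moreover have "closed S"
    unfolding S_def by (intro closed_Collect_eq continuous_intros continuous_on f)
  ultimately obtain p where p: "p \<in> S" and orth: "\<And>z. z \<in> S \<Longrightarrow> inner (a - p) z = 0"
    using orthogonal_projection_exists by blast
  define e where "e = a - p"
  have fe: "f e \<noteq> 0"
    using a p by (simp add: e_def S_def diff)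
  have ee: "inner e e \<noteq> 0"
    using fe zero by auto
  have "f x = inner x ((f e / inner e e) *\<^sub>R e)" for x
  proof -
    have "x - (f x / f e) *\<^sub>R e \<in> S"
      using fe by (simp add: S_def diff scale)
    then have "inner e (x - (f x / f e) *\<^sub>R e) = 0"
      using orth by (simp add: e_def)
    then show ?thesis
      using fe ee by (simp add: inner_diff_right inner_commute field_simps)
  qed
  then show ?thesis
    by blast
qed

lemma bounded_linear_adjoint_exists:
  fixes A :: "'a::{real_inner, complete_space} \<Rightarrow> 'a"
  assumes "bounded_linear A"
  shows "\<exists>A'. \<forall>x y. inner (A x) y = inner x (A' y)"
proof -
  have "bounded_linear (\<lambda>x. inner (A x) y)" for y
    using bounded_linear_compose[OF bounded_linear_inner_left assms] .
  then have "\<forall>y. \<exists>z. \<forall>x. inner (A x) y = inner x z"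
    by (intro allI riesz_representation)
  from choice[OF this] show ?thesis
    by blast
qed

section \<open>Cauchy-Schwarz for positive semidefinite forms\<close>

lemma nonneg_quadratic_discriminant:
  fixes a b r :: real
  assumes "\<And>t. 0 \<le> a + 2 * t * r + t\<^sup>2 * b"
  shows "r\<^sup>2 \<le> a * b"
proof (cases "b = 0")
  case True
  have "r = 0"
  proof (rule ccontr)
    assume "r \<noteq> 0"
    \<comment> \<open>At this \<open>t\<close> the expression \<open>a + 2 * t * r\<close> equals
      \<open>-1\<close>.\<close>
    then show False
      using assms[of "- (a + 1) / (2 * r)"] True by (simp add: field_simps)
  qed
  then show ?thesis
    using True by simp
next
  case False
  have "b > 0"
  proof (rule ccontr)
    assume "\<not> b > 0"
    with False have b: "b < 0"
      by simp
    \<comment> \<open>Chosen so that \<open>t \<ge> 1\<close> and \<open>- b * t\<close> exceeds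
      \<open>|a| + 2 |r|\<close>: the negative term \<open>t^2 * b\<close> then outweighs the other
      two.\<close>
    define t where "t = 1 + (\<bar>a\<bar> + 2 * \<bar>r\<bar>) / - b"
    have "0 \<le> (\<bar>a\<bar> + 2 * \<bar>r\<bar>) / - b"
      using b by (intro divide_nonneg_pos) auto
    then have t: "t \<ge> 1"
      by (simp add: t_def)
    have "- b * t > \<bar>a\<bar> + 2 * \<bar>r\<bar>"
      using b by (simp add: t_def field_simps mult_neg_neg)
    then have "t * (- b * t) > t * (\<bar>a\<bar> + 2 * \<bar>r\<bar>)"
      using t by (intro mult_strict_left_mono) auto
    moreover have "t * \<bar>a\<bar> \<ge> a"
      using t by (metis abs_ge_zero abs_le_D1 dual_order.trans mult_right_mono mult_1 order_refl)
    moreover have "t * \<bar>r\<bar> \<ge> t * r"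
      using t by (simp add: mult_left_mono)
    ultimately show False
      using assms[of t] by (simp add: algebra_simps power2_eq_square)
  qed
  then show ?thesis
    using assms[of "- r / b"] by (simp add: field_simps power2_eq_square)
qed

text \<open>The form at \<open>x + t y\<close> is a quadratic in \<open>t\<close> without negative
  values. The form may be degenerate: if it vanishes at one vector, then \<open>P\<close>
  annihilates that vector, which is how uniqueness of the square root uses it.\<close>

lemma positive_form_Cauchy_Schwarz:
  fixes P :: "'a::real_inner \<Rightarrow> 'a"
  assumes "linear P"
    and sym: "\<And>x y. inner (P x) y = inner x (P y)"
    and pos: "\<And>x. 0 \<le> inner (P x) x"
  shows "(inner (P x) y)\<^sup>2 \<le> inner (P x) x * inner (P y) y"
proof (rule nonneg_quadratic_discriminant)
  fix t
  have "0 \<le> inner (P (x + t *\<^sub>R y)) (x + t *\<^sub>R y)"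
    by (rule pos)
  also have "\<dots> = inner (P x) x + 2 * t * inner (P x) y + t\<^sup>2 * inner (P y) y"
    using sym[of y x]
    by (simp add: linear_add[OF assms(1)] linear_scale[OF assms(1)] inner_add_left
        inner_add_right algebra_simps power2_eq_square inner_commute)
  finally show "0 \<le> \<dots>" .
qed

section \<open>Square roots of positive operators\<close>

text \<open>
  The iterates are dominated in operator norm by the scalar iterates for \<open>A = 1\<close>, which increase
  and stay below \<open>1\<close>; this gives convergence. The limit \<open>Y\<close> satisfies \<open>Y = (A + Y\<^sup>2) / 2\<close>, that
  is, \<open>(1 - Y)\<^sup>2 = 1 - A\<close>.
\<close>

primrec sqrt_iter :: "('a::real_vector \<Rightarrow> 'a) \<Rightarrow> nat \<Rightarrow> 'a \<Rightarrow> 'a" where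
  "sqrt_iter A 0 = (\<lambda>x. 0)"
| "sqrt_iter A (Suc n) = (\<lambda>x. (1/2) *\<^sub>R (A x + sqrt_iter A n (sqrt_iter A n x)))"

primrec sqrt_majorant :: "nat \<Rightarrow> real" where
  "sqrt_majorant 0 = 0"
| "sqrt_majorant (Suc n) = (1 + (sqrt_majorant n)\<^sup>2) / 2"

definition sqrt_lim :: "('a::real_normed_vector \<Rightarrow> 'a) \<Rightarrow> 'a \<Rightarrow> 'a" where
  "sqrt_lim A x = lim (\<lambda>n. sqrt_iter A n x)"

lemma sqrt_majorant_bounds: "0 \<le> sqrt_majorant n \<and> sqrt_majorant n \<le> 1"
  by (induction n) (auto simp: power_le_one)

lemma sqrt_majorant_Suc_ge: "sqrt_majorant n \<le> sqrt_majorant (Suc n)"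
  using zero_le_power2[of "1 - sqrt_majorant n"] by (simp add: power2_diff)

lemma linear_sqrt_iter:
  assumes "linear A"
  shows "linear (sqrt_iter A n)"
proof (induction n)
  case 0
  show ?case
    by (simp add: linear_iff)
next
  case (Suc n)
  show ?case
    by (rule linearI)
      (simp_all add: linear_add[OF Suc] linear_scale[OF Suc] linear_add[OF assms]
        linear_scale[OF assms] algebra_simps)
qed

text \<open>The iterates are polynomials in \<open>A\<close>, so intertwining relations pass to
  them. Taking \<open>A' = A\<close> yields commutation; different operators serve to compare the
  roots of \<open>B' B\<close> and \<open>B B'\<close>.\<close>

lemma sqrt_iter_intertwine:
  assumes "linear B" and "\<And>x. B (A x) = A' (B x)"
  shows "B (sqrt_iter A n x) = sqrt_iter A' n (B x)"
  by (induction n arbitrary: x)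
    (simp_all add: linear_0[OF assms(1)] linear_add[OF assms(1)] linear_scale[OF assms(1)] assms(2))

lemma sqrt_iter_selfadjoint:
  assumes "\<And>x y. inner (A x) y = inner x (A y)"
  shows "inner (sqrt_iter A n x) y = inner x (sqrt_iter A n y)"
  by (induction n arbitrary: x y)
    (simp_all add: inner_add_left inner_add_right assms)

locale linear_contraction =
  fixes A :: "'a::{real_inner, complete_space} \<Rightarrow> 'a"
  assumes lin: "linear A" and contr: "norm (A x) \<le> norm x"
begin

lemma norm_sqrt_iter: "norm (sqrt_iter A n x) \<le> sqrt_majorant n * norm x"
proof (induction n arbitrary: x)
  case (Suc n)
  have "norm (sqrt_iter A n (sqrt_iter A n x)) \<le> sqrt_majorant n * (sqrt_majorant n * norm x)"
    using Suc[of "sqrt_iter A n x"] Suc[of x] sqrt_majorant_bounds[of n]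
    by (meson dual_order.trans mult_left_mono)
  then have "norm (A x + sqrt_iter A n (sqrt_iter A n x))
      \<le> norm x + sqrt_majorant n * (sqrt_majorant n * norm x)"
    using contr[of x] norm_triangle_ineq[of "A x" "sqrt_iter A n (sqrt_iter A n x)"] by linarith
  then show ?case
    unfolding sqrt_iter.simps sqrt_majorant.simps norm_scaleR
    by (simp add: power2_eq_square algebra_simps)
qed simp

lemma norm_sqrt_iter_le: "norm (sqrt_iter A n x) \<le> norm x"
  using sqrt_majorant_bounds[of n]
  by (intro order_trans[OF norm_sqrt_iter] mult_left_le_one_le) auto

text \<open>For consecutive iterates, \<open>Z^2 - Y^2 = Z (Z - Y) + (Z - Y) Y\<close>, and each
  factor is dominated by its scalar counterpart. The bounds are increments of the majorant, so they
  telescope.\<close>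

lemma norm_sqrt_iter_step:
  "norm (sqrt_iter A (Suc n) x - sqrt_iter A n x)
    \<le> (sqrt_majorant (Suc n) - sqrt_majorant n) * norm x"
proof (induction n arbitrary: x)
  case 0
  show ?case
    using contr[of x] by simp
next
  case (Suc n)
  let ?Y = "sqrt_iter A n" and ?Z = "sqrt_iter A (Suc n)"
  let ?y = "sqrt_majorant n" and ?z = "sqrt_majorant (Suc n)"
  have split: "?Z (?Z x) - ?Y (?Y x) = ?Z (?Z x - ?Y x) + (?Z (?Y x) - ?Y (?Y x))"
    using linear_diff[OF linear_sqrt_iter[OF lin, of "Suc n"]] by simp
  have "norm (?Z (?Z x - ?Y x)) \<le> ?z * ((?z - ?y) * norm x)"
    using norm_sqrt_iter[of "Suc n" "?Z x - ?Y x"] Suc[of x] sqrt_majorant_bounds[of "Suc n"]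
    by (meson dual_order.trans mult_left_mono)
  moreover have "norm (?Z (?Y x) - ?Y (?Y x)) \<le> (?z - ?y) * (?y * norm x)"
    using Suc[of "?Y x"] norm_sqrt_iter[of n x] sqrt_majorant_Suc_ge[of n]
    by (smt (verit) mult_left_mono)
  ultimately have "norm (?Z (?Z x) - ?Y (?Y x))
      \<le> ?z * ((?z - ?y) * norm x) + (?z - ?y) * (?y * norm x)"
    unfolding split by (rule norm_triangle_mono)
  also have "\<dots> = (?z\<^sup>2 - ?y\<^sup>2) * norm x"
    by (simp add: power2_eq_square algebra_simps del: sqrt_majorant.simps)
  finally have bnd: "norm (?Z (?Z x) - ?Y (?Y x)) \<le> (?z\<^sup>2 - ?y\<^sup>2) * norm x" .
  have step: "sqrt_iter A (Suc (Suc n)) x - ?Z x = (1/2) *\<^sub>R (?Z (?Z x) - ?Y (?Y x))"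
  proof -
    have *: "a - b = c *\<^sub>R (w - v)" if "a = c *\<^sub>R (u + w)" "b = c *\<^sub>R (u + v)"
      for a b u v w :: 'a and c
      using that by (simp add: algebra_simps)
    show ?thesis
      by (rule *) (rule fun_cong[OF sqrt_iter.simps(2)])+
  qed
  have maj: "sqrt_majorant (Suc (Suc n)) - ?z = (?z\<^sup>2 - ?y\<^sup>2) / 2"
    unfolding sqrt_majorant.simps(2)[of "Suc n"] by (simp add: field_simps)
  show ?case
    unfolding step maj norm_scaleR using bnd by (simp del: sqrt_iter.simps sqrt_majorant.simps)
qed

lemma norm_sqrt_iter_diff:
  "norm (sqrt_iter A (n + k) x - sqrt_iter A n x)
    \<le> (sqrt_majorant (n + k) - sqrt_majorant n) * norm x"
proof (induction k)
  case (Suc k)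
  then show ?case
    using norm_sqrt_iter_step[of "n + k" x]
      norm_triangle_ineq[of "sqrt_iter A (Suc (n + k)) x - sqrt_iter A (n + k) x"
        "sqrt_iter A (n + k) x - sqrt_iter A n x"]
    by (simp add: left_diff_distrib del: sqrt_iter.simps sqrt_majorant.simps)
qed simp

lemma tendsto_sqrt_lim: "(\<lambda>n. sqrt_iter A n x) \<longlonglongrightarrow> sqrt_lim A x"
proof -
  have "incseq sqrt_majorant"
    by (rule incseq_SucI) (rule sqrt_majorant_Suc_ge)
  then have "convergent sqrt_majorant"
    using incseq_convergent[of sqrt_majorant 1] sqrt_majorant_bounds
    by (metis convergent_def)
  then have cs: "Cauchy (\<lambda>n. sqrt_majorant n * norm x)"
    by (intro convergent_Cauchy convergent_mult convergent_const)
  have "Cauchy (\<lambda>n. sqrt_iter A n x)"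
  proof (rule CauchyI')
    fix e :: real assume "e > 0"
    then obtain M where M: "\<And>m n. m \<ge> M \<Longrightarrow> n \<ge> M \<Longrightarrow>
        norm (sqrt_majorant m * norm x - sqrt_majorant n * norm x) < e"
      using CauchyD[OF cs] by metis
    have "dist (sqrt_iter A m x) (sqrt_iter A n x) < e" if "m \<ge> M" "n > m" for m n
      using M[of n m] that norm_sqrt_iter_diff[of m "n - m" x]
      by (simp add: dist_norm norm_minus_commute left_diff_distrib)
    then show "\<exists>M. \<forall>m\<ge>M. \<forall>n>m. dist (sqrt_iter A m x) (sqrt_iter A n x) < e"
      by blast
  qed
  then show ?thesis
    unfolding sqrt_lim_def using Cauchy_convergent convergent_LIMSEQ_iff by blast
qed

lemma norm_sqrt_lim_le: "norm (sqrt_lim A x) \<le> norm x"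
  by (rule LIMSEQ_le_const2[OF tendsto_norm[OF tendsto_sqrt_lim]]) (use norm_sqrt_iter_le in auto)

lemma linear_sqrt_lim: "linear (sqrt_lim A)"
proof (rule linearI)
  show "sqrt_lim A (x + y) = sqrt_lim A x + sqrt_lim A y" for x y
    using tendsto_add[OF tendsto_sqrt_lim[of x] tendsto_sqrt_lim[of y]] tendsto_sqrt_lim[of "x + y"]
    by (simp add: linear_add[OF linear_sqrt_iter[OF lin]] LIMSEQ_unique)
  show "sqrt_lim A (r *\<^sub>R x) = r *\<^sub>R sqrt_lim A x" for r x
    using tendsto_scaleR[OF tendsto_const tendsto_sqrt_lim[of x], of r] tendsto_sqrt_lim[of "r *\<^sub>R x"]
    by (simp add: linear_scale[OF linear_sqrt_iter[OF lin]] LIMSEQ_unique)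
qed

lemma sqrt_lim_fixpoint: "sqrt_lim A x = (1/2) *\<^sub>R (A x + sqrt_lim A (sqrt_lim A x))"
proof -
  let ?Y = "sqrt_lim A"
  \<comment> \<open>Operator and argument both vary with \<open>n\<close>. Since all iterates are
    contractions, replacing the argument by its limit costs an error that tends to zero.\<close>
  have "(\<lambda>n. sqrt_iter A n (sqrt_iter A n x - ?Y x)) \<longlonglongrightarrow> 0"
  proof (rule Lim_null_comparison)
    show "\<forall>\<^sub>F n in sequentially. norm (sqrt_iter A n (sqrt_iter A n x - ?Y x))
        \<le> norm (sqrt_iter A n x - ?Y x)"
      using norm_sqrt_iter_le by simp
    show "(\<lambda>n. norm (sqrt_iter A n x - ?Y x)) \<longlonglongrightarrow> 0"
      using tendsto_sqrt_lim LIM_zero tendsto_norm_zero by blast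
  qed
  then have "(\<lambda>n. sqrt_iter A n (sqrt_iter A n x - ?Y x) + sqrt_iter A n (?Y x)) \<longlonglongrightarrow> 0 + ?Y (?Y x)"
    by (intro tendsto_add tendsto_sqrt_lim)
  then have "(\<lambda>n. sqrt_iter A n (sqrt_iter A n x)) \<longlonglongrightarrow> ?Y (?Y x)"
    by (simp add: linear_diff[OF linear_sqrt_iter[OF lin]])
  then have "(\<lambda>n. (1/2) *\<^sub>R (A x + sqrt_iter A n (sqrt_iter A n x))) \<longlonglongrightarrow> (1/2) *\<^sub>R (A x + ?Y (?Y x))"
    by (intro tendsto_intros)
  moreover have "(\<lambda>n. sqrt_iter A (Suc n) x) \<longlonglongrightarrow> ?Y x"
    using LIMSEQ_Suc[OF tendsto_sqrt_lim[of x]] .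
  ultimately show ?thesis
    by (simp add: LIMSEQ_unique)
qed

lemma sqrt_lim_selfadjoint:
  assumes "\<And>x y. inner (A x) y = inner x (A y)"
  shows "inner (sqrt_lim A x) y = inner x (sqrt_lim A y)"
proof -
  have "(\<lambda>n. inner (sqrt_iter A n x) y) \<longlonglongrightarrow> inner (sqrt_lim A x) y"
    "(\<lambda>n. inner x (sqrt_iter A n y)) \<longlonglongrightarrow> inner x (sqrt_lim A y)"
    by (intro tendsto_intros tendsto_sqrt_lim)+
  then show ?thesis
    using sqrt_iter_selfadjoint[OF assms] by (simp add: LIMSEQ_unique)
qed

end

lemma sqrt_lim_intertwine:
  assumes "bounded_linear B" and "\<And>x. B (A x) = A' (B x)"
    and "linear_contraction A" and "linear_contraction A'"
  shows "B (sqrt_lim A x) = sqrt_lim A' (B x)"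
proof -
  have "(\<lambda>n. B (sqrt_iter A n x)) \<longlonglongrightarrow> B (sqrt_lim A x)"
    using bounded_linear.tendsto[OF assms(1) linear_contraction.tendsto_sqrt_lim[OF assms(3)]] .
  moreover have "B (sqrt_iter A n x) = sqrt_iter A' n (B x)" for n
    using assms(1,2) by (intro sqrt_iter_intertwine bounded_linear.linear)
  ultimately show ?thesis
    using linear_contraction.tendsto_sqrt_lim[OF assms(4)] by (simp add: LIMSEQ_unique)
qed

text \<open>Scaling reduces to a contraction: with \<open>A = 1 - T / K^2\<close> and
  \<open>Y = sqrt_lim A\<close>, the relation \<open>(1 - Y)^2 = 1 - A\<close> makes
  \<open>K (1 - Y)\<close> a square root of \<open>T\<close>.\<close>

definition sqrt_op :: "real \<Rightarrow> ('a::real_normed_vector \<Rightarrow> 'a) \<Rightarrow> 'a \<Rightarrow> 'a" where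
  "sqrt_op K T x = K *\<^sub>R (x - sqrt_lim (\<lambda>x. x - (1 / K\<^sup>2) *\<^sub>R T x) x)"

text \<open>The conditions are symmetric in \<open>B\<close> and \<open>B'\<close> with a common
  \<open>K\<close>, so every result for \<open>B' B\<close> also holds for \<open>B B'\<close> at
  the same scale.\<close>

locale bounded_adjoint_pair =
  fixes B B' :: "'a::{real_inner, complete_space} \<Rightarrow> 'a" and K :: real
  assumes linB: "linear B" and linB': "linear B'"
    and adj: "inner (B x) y = inner x (B' y)"
    and K: "K > 0" and bndB: "norm (B x) \<le> K * norm x" and bndB': "norm (B' x) \<le> K * norm x"
begin

abbreviation R where "R \<equiv> sqrt_op K (\<lambda>x. B' (B x))"

text \<open>With \<open>c = 1 / K^2\<close>, the squared norm of the image is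
  \<open>|x|^2 - 2 c |B x|^2 + c^2 |B' B x|^2\<close>. The bound on \<open>B'\<close> makes the last
  term at most \<open>c |B x|^2\<close>.\<close>

lemma contraction: "linear_contraction (\<lambda>x. x - (1 / K\<^sup>2) *\<^sub>R B' (B x))"
proof (rule linear_contraction.intro)
  show "linear (\<lambda>x. x - (1 / K\<^sup>2) *\<^sub>R B' (B x))"
    by (rule linearI) (simp_all add: linear_add[OF linB] linear_scale[OF linB]
        linear_add[OF linB'] linear_scale[OF linB'] algebra_simps)
  fix x
  define c where "c = 1 / K\<^sup>2"
  have "(norm (B' (B x)))\<^sup>2 \<le> (K * norm (B x))\<^sup>2"
    using bndB'[of "B x"] by (intro power_mono) auto
  then have "c * (norm (B' (B x)))\<^sup>2 \<le> (norm (B x))\<^sup>2"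
    using K by (simp add: c_def power_mult_distrib field_simps)
  then have "c * (c * (norm (B' (B x)))\<^sup>2) \<le> c * (norm (B x))\<^sup>2"
    using K by (intro mult_left_mono) (auto simp: c_def)
  moreover have "0 \<le> c * (norm (B x))\<^sup>2"
    by (simp add: c_def)
  moreover have "(norm (x - c *\<^sub>R B' (B x)))\<^sup>2
      = (norm x)\<^sup>2 - 2 * (c * (norm (B x))\<^sup>2) + c * (c * (norm (B' (B x)))\<^sup>2)"
    unfolding power2_norm_eq_inner
    by (simp add: inner_diff_left inner_diff_right adj inner_commute[of "B' (B x)" x] algebra_simps)
  ultimately have "(norm (x - c *\<^sub>R B' (B x)))\<^sup>2 \<le> (norm x)\<^sup>2"
    by linarith
  then show "norm (x - (1 / K\<^sup>2) *\<^sub>R B' (B x)) \<le> norm x"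
    unfolding c_def by (rule power2_le_imp_le) simp
qed

lemma adj': "inner (B' x) y = inner x (B y)"
  using adj[of y x] by (simp add: inner_commute)

lemma bounded_linear_sqrt_op: "bounded_linear R"
proof (rule bounded_linear_intro)
  note lin = linear_contraction.linear_sqrt_lim[OF contraction]
  show "R (x + y) = R x + R y" "R (r *\<^sub>R x) = r *\<^sub>R R x" for x y r
    by (simp_all add: sqrt_op_def linear_add[OF lin] linear_scale[OF lin] algebra_simps)
  show "norm (R x) \<le> norm x * (2 * K)" for x
  proof -
    have "norm (x - sqrt_lim (\<lambda>x. x - (1 / K\<^sup>2) *\<^sub>R B' (B x)) x) \<le> 2 * norm x"
      using linear_contraction.norm_sqrt_lim_le[OF contraction, of x]
        norm_triangle_ineq4[of x "sqrt_lim (\<lambda>x. x - (1 / K\<^sup>2) *\<^sub>R B' (B x)) x"]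
      by linarith
    then show ?thesis
      using K by (simp add: sqrt_op_def)
  qed
qed

lemma sqrt_op_square: "R (R x) = B' (B x)"
proof -
  define Y where "Y = sqrt_lim (\<lambda>x. x - (1 / K\<^sup>2) *\<^sub>R B' (B x))"
  have lin: "linear Y"
    unfolding Y_def by (rule linear_contraction.linear_sqrt_lim[OF contraction])
  have R: "R x = K *\<^sub>R (x - Y x)" for x
    by (simp add: sqrt_op_def Y_def)
  have "Y x = (1/2) *\<^sub>R ((x - (1 / K\<^sup>2) *\<^sub>R B' (B x)) + Y (Y x))"
    unfolding Y_def by (rule linear_contraction.sqrt_lim_fixpoint[OF contraction])
  then have "2 *\<^sub>R Y x = 2 *\<^sub>R (1/2) *\<^sub>R ((x - (1 / K\<^sup>2) *\<^sub>R B' (B x)) + Y (Y x))"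
    by (rule arg_cong)
  also have "\<dots> = (x - (1 / K\<^sup>2) *\<^sub>R B' (B x)) + Y (Y x)"
    unfolding scaleR_scaleR by simp
  finally have "2 *\<^sub>R Y x = (x - (1 / K\<^sup>2) *\<^sub>R B' (B x)) + Y (Y x)" .
  then have "x - 2 *\<^sub>R Y x + Y (Y x) = (1 / K\<^sup>2) *\<^sub>R B' (B x)"
    by simp
  moreover have "R (R x) = K\<^sup>2 *\<^sub>R (x - 2 *\<^sub>R Y x + Y (Y x))"
    by (simp add: R linear_diff[OF lin] linear_scale[OF lin] algebra_simps
        power2_eq_square scaleR_2)
  ultimately show ?thesis
    using K by simp
qed

lemma sqrt_op_selfadjoint: "inner (R x) y = inner x (R y)"
proof -
  have "inner (x - (1 / K\<^sup>2) *\<^sub>R B' (B x)) y = inner x (y - (1 / K\<^sup>2) *\<^sub>R B' (B y))" for x y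
    by (simp add: inner_diff_left inner_diff_right adj adj')
  from linear_contraction.sqrt_lim_selfadjoint[OF contraction this]
  show ?thesis
    by (simp add: sqrt_op_def inner_diff_left inner_diff_right)
qed

text \<open>Positivity comes from contractivity of the limit \<open>Y\<close>:
  \<open>inner (Y x) x \<le> |x|^2\<close>.\<close>

lemma sqrt_op_nonneg: "0 \<le> inner (R x) x"
proof -
  let ?Y = "sqrt_lim (\<lambda>x. x - (1 / K\<^sup>2) *\<^sub>R B' (B x))"
  have "inner (?Y x) x \<le> norm (?Y x) * norm x"
    by (rule norm_cauchy_schwarz)
  also have "\<dots> \<le> norm x * norm x"
    using linear_contraction.norm_sqrt_lim_le[OF contraction] by (intro mult_right_mono) auto
  finally have "0 \<le> inner x x - inner (?Y x) x"
    by (simp add: power2_norm_eq_inner[symmetric] power2_eq_square)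
  then show ?thesis
    using K by (simp add: sqrt_op_def inner_diff_left)
qed

lemma swap: "bounded_adjoint_pair B' B K"
  by (intro bounded_adjoint_pair.intro linB linB' adj' K bndB bndB')

lemma bounded_linear_B: "bounded_linear B"
  using bndB
  by (intro bounded_linear_intro[where K = K] linear_add[OF linB] linear_scale[OF linB])
    (simp add: mult.commute)

text \<open>The root is a limit of polynomials in \<open>B' B\<close>. Here \<open>D\<close> will be
  a competing root, for uniqueness, or multiplication by a complex scalar, for complex
  linearity.\<close>

lemma sqrt_op_commute:
  assumes D: "bounded_linear D" and "\<And>x. D (B' (B x)) = B' (B (D x))"
  shows "D (R x) = R (D x)"
proof -
  interpret D: bounded_linear D by fact
  have "D (sqrt_lim (\<lambda>x. x - (1 / K\<^sup>2) *\<^sub>R B' (B x)) x)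
      = sqrt_lim (\<lambda>x. x - (1 / K\<^sup>2) *\<^sub>R B' (B x)) (D x)"
    by (intro sqrt_lim_intertwine D contraction) (simp add: D.diff D.scale assms(2))
  then show ?thesis
    by (simp add: sqrt_op_def D.diff D.scale)
qed

text \<open>From \<open>B (B' B) = (B B') B\<close>, the map \<open>B\<close> carries one iteration
  to the other. This takes the place of a polar decomposition in the mixed Schwarz
  inequality.\<close>

lemma sqrt_op_intertwine: "B (R x) = sqrt_op K (\<lambda>x. B (B' x)) (B x)"
proof -
  interpret B: bounded_linear B
    by (rule bounded_linear_B)
  have "B (sqrt_lim (\<lambda>x. x - (1 / K\<^sup>2) *\<^sub>R B' (B x)) x)
      = sqrt_lim (\<lambda>x. x - (1 / K\<^sup>2) *\<^sub>R B (B' x)) (B x)"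
    by (intro sqrt_lim_intertwine B.bounded_linear_axioms contraction
        bounded_adjoint_pair.contraction[OF swap]) (simp add: B.diff B.scale)
  then show ?thesis
    by (simp add: sqrt_op_def B.diff B.scale)
qed

text \<open>
  With \<open>D = P - R\<close>, the vector \<open>y = D x\<close> satisfies \<open>(P + R) y = 0\<close>, so both positive operators
  annihilate \<open>y\<close>, and \<open>\<parallel>D x\<parallel>\<^sup>2 = \<langle>D y, x\<rangle> = 0\<close>.
\<close>

lemma sqrt_op_unique:
  assumes P: "bounded_linear P" "\<And>x y. inner (P x) y = inner x (P y)"
    "\<And>x. 0 \<le> inner (P x) x" "\<And>x. P (P x) = B' (B x)"
  shows "P = R"
proof
  fix x
  note linP = bounded_linear.linear[OF P(1)] and linR = bounded_linear.linear[OF bounded_linear_sqrt_op]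
  have comm: "P (R x) = R (P x)" for x
    using P(4) by (intro sqrt_op_commute P(1)) metis
  define y where "y = P x - R x"
  \<comment> \<open>Since \<open>P\<close> and \<open>R\<close> commute,
    \<open>(P + R) (P - R) = P^2 - R^2 = 0\<close>.\<close>
  have "P y + R y = 0"
    by (simp add: y_def linear_diff[OF linP] linear_diff[OF linR] comm P(4) sqrt_op_square)
  then have "inner (P y) y + inner (R y) y = 0"
    by (metis inner_add_left inner_zero_left)
  then have z: "inner (P y) y = 0" "inner (R y) y = 0"
    using P(3)[of y] sqrt_op_nonneg[of y] by linarith+
  have "(inner (P y) x)\<^sup>2 \<le> 0" "(inner (R y) x)\<^sup>2 \<le> 0"
    using positive_form_Cauchy_Schwarz[OF linP P(2,3), of y x]
      positive_form_Cauchy_Schwarz[OF linR sqrt_op_selfadjoint sqrt_op_nonneg, of y x] z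
    by simp_all
  then have "inner (P y - R y) x = 0"
    by (simp add: inner_diff_left)
  then have "inner y y = 0"
    by (simp add: inner_diff_left inner_diff_right P(2) sqrt_op_selfadjoint y_def)
  then show "P x = R x"
    by (simp add: y_def)
qed

text \<open>
  For \<open>x = R u\<close> this is Cauchy-Schwarz for the form of \<open>Q\<close>, since \<open>B R u = Q B u\<close>. It extends to
  the closure of the range of \<open>R\<close>, and on the orthogonal complement both \<open>B\<close> and \<open>R\<close> vanish.
\<close>

lemma mixed_Schwarz:
  defines "Q \<equiv> sqrt_op K (\<lambda>x. B (B' x))"
  shows "(inner (B x) y)\<^sup>2 \<le> inner (R x) x * inner (Q y) y"
proof -
  interpret sw: bounded_adjoint_pair B' B K by (rule swap)
  interpret R: bounded_linear R by (rule bounded_linear_sqrt_op)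
  interpret B: bounded_linear B
    by (rule bounded_linear_B)
  have range: "(inner (B v) y)\<^sup>2 \<le> inner (R v) v * inner (Q y) y" if v: "v \<in> range R" for v
  proof -
    obtain u where u: "v = R u"
      using v by blast
    have "(inner (Q (B u)) y)\<^sup>2 \<le> inner (Q (B u)) (B u) * inner (Q y) y"
      unfolding Q_def
      by (intro positive_form_Cauchy_Schwarz sw.sqrt_op_selfadjoint sw.sqrt_op_nonneg
          bounded_linear.linear sw.bounded_linear_sqrt_op)
    moreover have "inner (Q (B u)) (B u) = inner (R v) v"
    proof -
      have "inner (Q (B u)) (B u) = inner (B (R u)) (B u)"
        by (simp only: Q_def sqrt_op_intertwine)
      also have "\<dots> = inner (R u) (R (R u))"
        by (simp only: adj sqrt_op_square)
      finally show ?thesis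
        by (simp only: u inner_commute)
    qed
    ultimately show ?thesis
      by (simp add: u sqrt_op_intertwine Q_def)
  qed
  have closure: "(inner (B v) y)\<^sup>2 \<le> inner (R v) v * inner (Q y) y" if "v \<in> closure (range R)" for v
  proof -
    have "closed {v. (inner (B v) y)\<^sup>2 \<le> inner (R v) v * inner (Q y) y}"
      by (intro closed_Collect_le continuous_intros R.continuous_on B.continuous_on)
    then have "closure (range R) \<subseteq> {v. (inner (B v) y)\<^sup>2 \<le> inner (R v) v * inner (Q y) y}"
      using range by (intro closure_minimal) auto
    then show ?thesis
      using that by blast
  qed
  have "subspace (closure (range R))"
    by (intro subspace_closure linear_subspace_image R.linear subspace_UNIV)
  then obtain v where v: "v \<in> closure (range R)"
    and orth: "\<And>z. z \<in> closure (range R) \<Longrightarrow> inner (x - v) z = 0"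
    using orthogonal_projection_exists[of "closure (range R)" x] by auto
  \<comment> \<open>Self-adjointness moves one \<open>R\<close> across, and
    \<open>R (R (x - v))\<close> lies in the range of \<open>R\<close>, to which
    \<open>x - v\<close> is orthogonal.\<close>
  have "inner (R (x - v)) (R (x - v)) = 0"
    using orth[of "R (R (x - v))"] closure_subset[of "range R"] by (auto simp: sqrt_op_selfadjoint)
  then have R0: "R (x - v) = 0"
    by simp
  have "inner (B (x - v)) (B (x - v)) = inner (x - v) (R (R (x - v)))"
    by (simp only: adj sqrt_op_square)
  then have "inner (B (x - v)) (B (x - v)) = 0"
    by (simp add: R0 R.zero)
  then have "B x = B v"
    by (simp add: B.diff)
  moreover have "R x = R v"
    using R0 by (simp add: R.diff)
  moreover have "inner (R v) x = inner (R v) v"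
    using orth[of "R v"] closure_subset[of "range R"]
    by (auto simp: inner_diff_left inner_commute)
  ultimately show ?thesis
    using closure[OF v] by simp
qed

end

section \<open>Adjoint and absolute value on a complex Hilbert space\<close>

text \<open>Rotating a vector or an operator by such a phase turns a bound on a real part into a
  bound on a modulus.\<close>

lemma unit_phase: "\<exists>c. cmod c = 1 \<and> c * z = complex_of_real (cmod z)"
proof (cases "z = 0")
  case True
  then show ?thesis
    by (intro exI[of _ 1]) simp
next
  case False
  then show ?thesis
    by (intro exI[of _ "cnj z / cmod z"])
      (simp add: norm_divide complex_norm_square[symmetric] mult.commute power2_eq_square)
qed

lemma inner_eqI:
  fixes y z :: "'a::real_inner"
  assumes "\<And>x. inner x y = inner x z"
  shows "y = z"
  using assms vector_eq_ldot[of y z] by blast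

context complex_inner
begin

lemma cinner_add_right: "cinner x (y + z) = cinner x y + cinner x z"
  by (simp add: cinner_commute[of x] cinner_add_left)

lemma cinner_scaleC_right: "cinner x (c *\<^sub>C y) = cnj c * cinner x y"
  by (simp add: cinner_commute[of x] cinner_scaleC_left)

text \<open>Together with \<open>Re_cinner\<close> this recovers the complex inner product from the
  real one, so identities for complex-linear maps can be transferred.\<close>

lemma Im_cinner: "Im (cinner x y) = inner ((- \<i>) *\<^sub>C x) y"
  by (simp add: Re_cinner[symmetric] cinner_scaleC_left)

end

lemma cinner_diff_left: "cinner (x - y) z = cinner x z - cinner y z"
  for x :: "'a::complex_inner"
  using cinner_add_left[of "x - y" y z] by simp

lemma cinner_zero_left [simp]: "cinner 0 z = 0"
  for z :: "'a::complex_inner"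
  using cinner_diff_left[of z z z] by simp

lemma cinner_scaleR_left: "cinner (r *\<^sub>R x) y = r * cinner x y"
  for x :: "'a::complex_inner"
  by (simp add: cinner_scaleC_left scaleC_complex_of_real[symmetric])

lemma cinner_scaleR_right: "cinner x (r *\<^sub>R y) = r * cinner x y"
  for x :: "'a::complex_inner"
  by (simp add: cinner_scaleC_right scaleC_complex_of_real[symmetric])

lemma norm_scaleC: "norm (c *\<^sub>C x) = cmod c * norm x"
  for x :: "'a::complex_inner"
proof -
  have "complex_of_real ((norm (c *\<^sub>C x))\<^sup>2) = c * cnj c * complex_of_real ((norm x)\<^sup>2)"
    by (simp only: cinner_self[symmetric] cinner_scaleC_left cinner_scaleC_right mult_ac)
  also have "\<dots> = complex_of_real ((cmod c * norm x)\<^sup>2)"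
    by (simp only: complex_norm_square[symmetric] of_real_mult[symmetric] power_mult_distrib)
  finally have "(norm (c *\<^sub>C x))\<^sup>2 = (cmod c * norm x)\<^sup>2"
    by (simp only: of_real_eq_iff)
  then show ?thesis
    by (rule power2_eq_imp_eq) auto
qed

lemma bounded_linear_scaleC: "bounded_linear (\<lambda>x::'a::complex_inner. c *\<^sub>C x)"
  by (rule bounded_linear_intro[where K = "cmod c"])
    (simp_all add: scaleC_add_right norm_scaleC scaleC_complex_of_real[symmetric] scaleC_scaleC
      mult.commute)

lemma cmod_cinner_le: "cmod (cinner x y) \<le> norm x * norm y"
  for x :: "'a::complex_inner"
proof -
  obtain c where c: "cmod c = 1" "c * cinner x y = complex_of_real (cmod (cinner x y))"
    using unit_phase by blast
  have "cmod (cinner x y) = inner (c *\<^sub>C x) y"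
    by (simp add: Re_cinner[symmetric] cinner_scaleC_left c)
  also have "\<dots> \<le> norm x * norm y"
    using norm_cauchy_schwarz[of "c *\<^sub>C x" y] c by (simp add: norm_scaleC)
  finally show ?thesis .
qed

lemma bounded_clinearD:
  assumes "bounded_clinear A"
  shows "bounded_linear A" "A (x + y) = A x + A y" "A (x - y) = A x - A y"
    "A (r *\<^sub>R x) = r *\<^sub>R A x" "A (c *\<^sub>C x) = c *\<^sub>C A x" "A 0 = 0"
proof -
  show A: "bounded_linear A" "A (c *\<^sub>C x) = c *\<^sub>C A x"
    using assms by (auto simp: bounded_clinear_def)
  interpret bounded_linear A by fact
  show "A (x + y) = A x + A y" "A (x - y) = A x - A y"
    "A (r *\<^sub>R x) = r *\<^sub>R A x" "A 0 = 0"
    by (simp_all add: add diff scale zero)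
qed

lemma bounded_clinear_add:
  "bounded_clinear A \<Longrightarrow> bounded_clinear B \<Longrightarrow> bounded_clinear (\<lambda>x. A x + B x)"
  by (simp add: bounded_clinear_def bounded_linear_add scaleC_add_right)

lemma bounded_clinear_scaleC:
  "bounded_clinear A \<Longrightarrow> bounded_clinear (\<lambda>x. c *\<^sub>C A x)"
  using bounded_linear_compose[OF bounded_linear_scaleC[of c], of A]
  by (simp add: bounded_clinear_def scaleC_scaleC mult.commute)

lemma bounded_clinear_diff:
  assumes "bounded_clinear A" "bounded_clinear B"
  shows "bounded_clinear (\<lambda>x. A x - B x)"
  using assms
  by (simp add: bounded_clinear_def bounded_linear_sub
      linear_diff[OF bounded_linear.linear[OF bounded_linear_scaleC]])

lemma bounded_clinear_compose:
  "bounded_clinear A \<Longrightarrow> bounded_clinear B \<Longrightarrow> bounded_clinear (\<lambda>x. A (B x))"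
  by (simp add: bounded_clinear_def bounded_linear_compose)

text \<open>The real adjoint is already the complex one: because \<open>A\<close> commutes with
  multiplication by \<open>- \<i>\<close>, the imaginary parts agree as well. Uniqueness then
  justifies the definite description.\<close>

lemma cinner_cadjoint:
  assumes A: "bounded_clinear A"
  shows "cinner (A x) y = cinner x (cadjoint A y)"
proof -
  obtain A' where A': "\<And>x y. inner (A x) y = inner x (A' y)"
    using bounded_linear_adjoint_exists[OF bounded_clinearD(1)[OF A]] by blast
  have eq: "cinner (A x) y = cinner x (A' y)" for x y
    by (simp add: complex_eq_iff Re_cinner Im_cinner A' bounded_clinearD(5)[OF A, symmetric])
  have "\<exists>!A'. \<forall>x y. cinner (A x) y = cinner x (A' y)"
  proof (rule ex1I[of _ A'])
    fix A'' assume A'': "\<forall>x y. cinner (A x) y = cinner x (A'' y)"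
    have "inner x (A'' y) = inner x (A' y)" for x y
      by (metis A'' eq Re_cinner)
    then have "A'' y = A' y" for y
      by (rule inner_eqI)
    then show "A'' = A'"
      by (rule ext)
  qed (simp add: eq)
  from theI'[OF this] show ?thesis
    unfolding cadjoint_def by blast
qed

lemma inner_cadjoint:
  "bounded_clinear A \<Longrightarrow> inner (A x) y = inner x (cadjoint A y)"
  by (simp add: cinner_cadjoint flip: Re_cinner)

text \<open>A bound \<open>K\<close> for \<open>A\<close> also bounds the adjoint:
  \<open>|A* y|^2 = <A A* y, y> \<le> K |A* y| |y|\<close>, and a factor cancels.\<close>

lemma bounded_adjoint_pair_cadjoint:
  assumes A: "bounded_clinear A"
  shows "\<exists>K. bounded_adjoint_pair A (cadjoint A) K"
proof -
  obtain K where K: "K > 0" "\<And>x. norm (A x) \<le> norm x * K"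
    using bounded_linear.pos_bounded[OF bounded_clinearD(1)[OF A]] by blast
  have "norm (cadjoint A y) \<le> K * norm y" for y
  proof -
    have "norm (cadjoint A y) * norm (cadjoint A y) = inner (A (cadjoint A y)) y"
      by (simp add: inner_cadjoint[OF A] power2_norm_eq_inner[symmetric] power2_eq_square)
    also have "\<dots> \<le> norm (A (cadjoint A y)) * norm y"
      by (rule norm_cauchy_schwarz)
    also have "\<dots> \<le> norm (cadjoint A y) * K * norm y"
      using K by (intro mult_right_mono) auto
    finally have "norm (cadjoint A y) * norm (cadjoint A y) \<le> norm (cadjoint A y) * (K * norm y)"
      by (simp add: mult.assoc)
    then show ?thesis
      using K by (cases "cadjoint A y = 0") auto
  qed
  moreover have "linear (cadjoint A)"
  proof (rule linearI)
    have "inner x (cadjoint A (b1 + b2)) = inner x (cadjoint A b1 + cadjoint A b2)" for x b1 b2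
      by (simp add: inner_cadjoint[OF A, symmetric] inner_add_right)
    then show "cadjoint A (b1 + b2) = cadjoint A b1 + cadjoint A b2" for b1 b2
      by (rule inner_eqI)
    have "inner x (cadjoint A (r *\<^sub>R b)) = inner x (r *\<^sub>R cadjoint A b)" for x r b
      by (simp add: inner_cadjoint[OF A, symmetric])
    then show "cadjoint A (r *\<^sub>R b) = r *\<^sub>R cadjoint A b" for r b
      by (rule inner_eqI)
  qed
  ultimately show ?thesis
    using K bounded_linear.linear[OF bounded_clinearD(1)[OF A]] inner_cadjoint[OF A]
    by (intro exI[of _ K] bounded_adjoint_pair.intro) (auto simp: mult.commute)
qed

lemma bounded_clinear_cadjoint:
  assumes A: "bounded_clinear A"
  shows "bounded_clinear (cadjoint A)"
proof -
  obtain K where "bounded_adjoint_pair A (cadjoint A) K"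
    using bounded_adjoint_pair_cadjoint[OF A] by blast
  then have "bounded_linear (cadjoint A)"
    by (rule bounded_adjoint_pair.bounded_linear_B[OF bounded_adjoint_pair.swap])
  moreover have "cadjoint A (c *\<^sub>C y) = c *\<^sub>C cadjoint A y" for c y
  proof -
    have "cinner x (cadjoint A (c *\<^sub>C y)) = cinner x (c *\<^sub>C cadjoint A y)" for x
      by (simp add: cinner_cadjoint[OF A, symmetric] cinner_scaleC_right)
    then have "inner x (cadjoint A (c *\<^sub>C y)) = inner x (c *\<^sub>C cadjoint A y)" for x
      by (metis Re_cinner)
    then show ?thesis
      by (rule inner_eqI)
  qed
  ultimately show ?thesis
    by (simp add: bounded_clinear_def)
qed

lemma cadjoint_cadjoint:
  assumes A: "bounded_clinear A"
  shows "cadjoint (cadjoint A) = A"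
proof
  fix y
  have "inner x (cadjoint (cadjoint A) y) = inner x (A y)" for x
    using inner_cadjoint[OF bounded_clinear_cadjoint[OF A], of x y] inner_cadjoint[OF A, of y x]
    by (simp add: inner_commute)
  then show "cadjoint (cadjoint A) y = A y"
    by (rule inner_eqI)
qed

lemma positive_op_selfadjoint:
  assumes "positive_op P"
  shows "inner (P x) y = inner x (P y)"
proof -
  have P: "bounded_clinear P" and Im0: "Im (cinner (P z) z) = 0" for z
    using assms by (auto simp: positive_op_def complex_nonneg_Reals_iff)
  \<comment> \<open>Polarization: the cross terms are \<open>\<i> <P x, y> - \<i> <P y, x>\<close>,
    whose imaginary part is the difference of the two real inner products.\<close>
  have "Im (cinner (P (\<i> *\<^sub>C x + y)) (\<i> *\<^sub>C x + y)) = 0"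
    by (rule Im0)
  then have "Re (cinner (P x) y) - Re (cinner (P y) x) = 0"
    using Im0[of x] Im0[of y]
    by (simp add: bounded_clinearD(2,5)[OF P] cinner_add_left cinner_add_right
        cinner_scaleC_left cinner_scaleC_right)
  then show ?thesis
    by (simp add: Re_cinner inner_commute)
qed

text \<open>Real self-adjointness and complex linearity give
  \<open>Im <P x, x> = Im <x, P x>\<close>, while conjugate symmetry makes these two opposite; hence
  the form is real.\<close>

lemma positive_opI:
  assumes P: "bounded_clinear P"
    and sym: "\<And>x y. inner (P x) y = inner x (P y)" and pos: "\<And>x. 0 \<le> inner (P x) x"
  shows "positive_op P"
proof -
  have "Im (cinner (P x) x) = Im (cinner x (P x))" for x
    by (simp only: Im_cinner bounded_clinearD(5)[OF P, symmetric] sym)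
  then have "Im (cinner (P x) x) = 0" for x
    using arg_cong[OF cinner_commute[of "P x" x], of Im for x] by simp
  then show ?thesis
    using P pos by (simp add: positive_op_def complex_nonneg_Reals_iff Re_cinner)
qed

text \<open>This identifies the definite description with the constructed root. The root is complex
  linear because scalars commute with \<open>A* A\<close>; any other candidate is self-adjoint for
  the real inner product, so \<open>sqrt_op_unique\<close> applies to it.\<close>

lemma abs_op_eq_sqrt_op:
  assumes A: "bounded_clinear A" and pair: "bounded_adjoint_pair A (cadjoint A) K"
  shows "abs_op A = sqrt_op K (\<lambda>x. cadjoint A (A x))"
    and "positive_op (sqrt_op K (\<lambda>x. cadjoint A (A x)))"
proof -
  interpret bounded_adjoint_pair A "cadjoint A" K by fact
  note A' = bounded_clinear_cadjoint[OF A]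
  have "c *\<^sub>C R x = R (c *\<^sub>C x)" for c x
    by (intro sqrt_op_commute bounded_linear_scaleC)
      (simp add: bounded_clinearD(5)[OF A] bounded_clinearD(5)[OF A'])
  then have "bounded_clinear R"
    using bounded_linear_sqrt_op by (simp add: bounded_clinear_def)
  then show pos: "positive_op R"
    using sqrt_op_selfadjoint sqrt_op_nonneg by (rule positive_opI)
  show "abs_op A = R"
    unfolding abs_op_def
  proof (rule the_equality)
    show "positive_op R \<and> R \<circ> R = cadjoint A \<circ> A"
      using pos sqrt_op_square by (simp add: fun_eq_iff)
  next
    fix P assume P: "positive_op P \<and> P \<circ> P = cadjoint A \<circ> A"
    show "P = R"
    proof (rule sqrt_op_unique)
      show "bounded_linear P" "0 \<le> inner (P x) x" for x
        using P by (auto simp: positive_op_def bounded_clinear_def complex_nonneg_Reals_iff Re_cinner)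
      show "inner (P x) y = inner x (P y)" for x y
        using P positive_op_selfadjoint by blast
      show "P (P x) = cadjoint A (A x)" for x
        using P by (metis comp_apply)
    qed
  qed
qed

lemma positive_abs_op:
  assumes "bounded_clinear A"
  shows "positive_op (abs_op A)"
  using bounded_adjoint_pair_cadjoint[OF assms] abs_op_eq_sqrt_op[OF assms] by metis

lemma positive_op_cinner:
  assumes "positive_op P"
  shows "cinner (P x) x = complex_of_real (inner (P x) x)" "0 \<le> inner (P x) x"
  using assms
  by (auto simp: positive_op_def complex_nonneg_Reals_iff Re_cinner complex_eq_iff)

text \<open>The real mixed Schwarz inequality is applied to \<open>c x\<close> and \<open>x\<close>,
  where the phase \<open>c\<close> makes \<open><A (c x), x>\<close> equal to the modulus of
  \<open><A x, x>\<close>. The form of \<open>abs_op A\<close> takes the same value at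
  \<open>c x\<close> and \<open>x\<close>.\<close>

lemma cinner_abs_op_Schwarz:
  assumes A: "bounded_clinear A"
  shows "(cmod (cinner (A x) x))\<^sup>2
    \<le> inner (abs_op A x) x * inner (abs_op (cadjoint A) x) x"
proof -
  obtain K where pair: "bounded_adjoint_pair A (cadjoint A) K"
    using bounded_adjoint_pair_cadjoint[OF A] by blast
  note A' = bounded_clinear_cadjoint[OF A]
  have abs: "abs_op A = sqrt_op K (\<lambda>x. cadjoint A (A x))"
    by (rule abs_op_eq_sqrt_op[OF A pair])
  have "bounded_adjoint_pair (cadjoint A) (cadjoint (cadjoint A)) K"
    using bounded_adjoint_pair.swap[OF pair] by (simp add: cadjoint_cadjoint[OF A])
  from abs_op_eq_sqrt_op(1)[OF A' this]
  have abs': "abs_op (cadjoint A) = sqrt_op K (\<lambda>x. A (cadjoint A x))"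
    by (simp add: cadjoint_cadjoint[OF A])
  have "bounded_clinear (abs_op A)"
    using positive_abs_op[OF A] by (simp add: positive_op_def)
  note absC = bounded_clinearD(5)[OF this]
  obtain c where c: "cmod c = 1" "c * cinner (A x) x = complex_of_real (cmod (cinner (A x) x))"
    using unit_phase by blast
  have "inner (A (c *\<^sub>C x)) x = cmod (cinner (A x) x)"
    by (simp add: Re_cinner[symmetric] bounded_clinearD(5)[OF A] cinner_scaleC_left c)
  moreover have "inner (abs_op A (c *\<^sub>C x)) (c *\<^sub>C x) = inner (abs_op A x) x"
  proof -
    have "cnj c * (c * z) = z" for z
      using c(1) complex_norm_square[of c] by (simp add: mult.commute flip: mult.assoc)
    then have "cinner (abs_op A (c *\<^sub>C x)) (c *\<^sub>C x) = cinner (abs_op A x) x"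
      by (simp only: absC cinner_scaleC_left cinner_scaleC_right)
    then show ?thesis
      by (simp only: Re_cinner[symmetric])
  qed
  ultimately show ?thesis
    using bounded_adjoint_pair.mixed_Schwarz[OF pair, of "c *\<^sub>C x" x] by (simp add: abs abs')
qed

section \<open>Numerical radius\<close>

lemma sup_unit_upper:
  assumes "\<And>x. norm x = 1 \<Longrightarrow> f x \<le> M" and "norm x = 1"
  shows "f x \<le> sup_unit f"
proof -
  have "bdd_above (f ` {x. norm x = 1})"
    using assms(1) by (intro bdd_aboveI2[where M = M]) auto
  then have "f x \<le> (SUP x\<in>{x. norm x = 1}. f x)"
    using assms(2) by (intro cSUP_upper) auto
  then show ?thesis
    using assms(2) by (auto simp: sup_unit_def)
qed

text \<open>The condition \<open>0 \<le> K\<close> covers the zero space, where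
  \<open>sup_unit\<close> has the value 0.\<close>

lemma sup_unit_least:
  assumes "\<And>x. norm x = 1 \<Longrightarrow> f x \<le> K" and "0 \<le> K"
  shows "sup_unit f \<le> K"
  using assms by (auto simp: sup_unit_def intro!: cSUP_least)

lemma sup_unit_nonneg:
  assumes "\<And>x. norm x = 1 \<Longrightarrow> f x \<le> M" and "\<And>x. norm x = 1 \<Longrightarrow> 0 \<le> f x"
  shows "0 \<le> sup_unit f"
proof (cases "\<exists>x::'a. norm x = 1")
  case True
  then show ?thesis
    using sup_unit_upper[of f M] assms by (meson order_trans)
qed (simp add: sup_unit_def)

lemma bounded_clinear_cinner_bound:
  assumes "bounded_clinear A"
  shows "\<exists>K. \<forall>x. norm x = 1 \<longrightarrow> cmod (cinner (A x) x) \<le> K"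
proof -
  obtain K where "\<And>x. norm (A x) \<le> norm x * K"
    using bounded_linear.bounded[OF bounded_clinearD(1)[OF assms]] by blast
  then have "cmod (cinner (A x) x) \<le> K" if "norm x = 1" for x
    using cmod_cinner_le[of "A x" x] that by (metis mult.right_neutral mult_1 order_trans)
  then show ?thesis
    by blast
qed

lemma numerical_radius_nonneg:
  assumes "bounded_clinear A"
  shows "0 \<le> numerical_radius A"
  using bounded_clinear_cinner_bound[OF assms] unfolding numerical_radius_def
  by (auto intro: sup_unit_nonneg)

lemma numerical_radius_unit:
  assumes "bounded_clinear A" and "norm x = 1"
  shows "cmod (cinner (A x) x) \<le> numerical_radius A"
proof -
  obtain K where "\<And>x. norm x = 1 \<Longrightarrow> cmod (cinner (A x) x) \<le> K"
    using bounded_clinear_cinner_bound[OF assms(1)] by blast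
  from sup_unit_upper[where f = "\<lambda>x. cmod (cinner (A x) x)", OF this assms(2)]
  show ?thesis
    by (simp add: numerical_radius_def)
qed

lemma cmod_cinner_le_numerical_radius:
  assumes A: "bounded_clinear A"
  shows "cmod (cinner (A x) x) \<le> numerical_radius A * (norm x)\<^sup>2"
proof (cases "x = 0")
  case False
  define u where "u = (1 / norm x) *\<^sub>R x"
  have x: "x = norm x *\<^sub>R u" and u: "norm u = 1"
    using False by (simp_all add: u_def)
  have "cinner (A x) x = cinner (A (norm x *\<^sub>R u)) (norm x *\<^sub>R u)"
    using x by simp
  also have "\<dots> = complex_of_real ((norm x)\<^sup>2) * cinner (A u) u"
    by (simp add: bounded_clinearD(4)[OF A] cinner_scaleR_left cinner_scaleR_right power2_eq_square)
  finally show ?thesis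
    using mult_right_mono[OF numerical_radius_unit[OF A u], of "(norm x)\<^sup>2"]
    by (simp add: norm_mult norm_power mult.commute)
qed (simp add: bounded_clinearD(6)[OF A])

lemma numerical_radius_least:
  assumes "\<And>x. norm x = 1 \<Longrightarrow> cmod (cinner (A x) x) \<le> K" and "0 \<le> K"
  shows "numerical_radius A \<le> K"
  unfolding numerical_radius_def using assms by (rule sup_unit_least)

text \<open>
  For \<open>r > w(A)\<close>, the form of \<open>r - A\<close> at \<open>(r + A) x\<close> plus the form of \<open>r + A\<close> at \<open>(r - A) x\<close>
  equals \<open>2 r \<langle>(r\<^sup>2 - A\<^sup>2) x, x\<rangle>\<close>, and both forms have nonnegative real part.
\<close>

lemma Re_cinner_square_le:
  assumes A: "bounded_clinear A" and r: "numerical_radius A < r"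
  shows "Re (cinner (A (A x)) x) \<le> r\<^sup>2 * (norm x)\<^sup>2"
proof -
  note lin = bounded_clinearD[OF A]
  \<comment> \<open>The strict inequality gives \<open>r > 0\<close> even if the numerical radius is
    0, so the factor \<open>2 * r\<close> can be cancelled below.\<close>
  have r0: "r > 0"
    using numerical_radius_nonneg[OF A] r by linarith
  have bound: "\<bar>inner (A y) y\<bar> \<le> r * inner y y" for y
  proof -
    have "\<bar>inner (A y) y\<bar> \<le> cmod (cinner (A y) y)"
      using abs_Re_le_cmod[of "cinner (A y) y"] by (simp add: Re_cinner)
    also have "\<dots> \<le> numerical_radius A * (norm y)\<^sup>2"
      by (rule cmod_cinner_le_numerical_radius[OF A])
    also have "\<dots> \<le> r * (norm y)\<^sup>2"
      using r by (intro mult_right_mono) auto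
    finally show ?thesis
      by (simp only: power2_norm_eq_inner)
  qed
  define y z where "y = r *\<^sub>R x + A x" and "z = r *\<^sub>R x - A x"
  have "0 \<le> (r * inner y y - inner (A y) y) + (r * inner z z + inner (A z) z)"
    using bound[of y] bound[of z] by linarith
  also have "\<dots> = 2 * r * (r\<^sup>2 * inner x x - inner (A (A x)) x)"
    unfolding y_def z_def
    by (simp add: lin(2-4) inner_add_left inner_add_right inner_diff_left inner_diff_right
        inner_commute[of x "A x"] algebra_simps power2_eq_square)
  finally have "0 \<le> r\<^sup>2 * inner x x - inner (A (A x)) x"
    using r0 by (simp add: zero_le_mult_iff)
  then show ?thesis
    by (simp add: Re_cinner power2_norm_eq_inner)
qed

text \<open>With \<open>d\<close> a square root of the phase \<open>c\<close>, the operator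
  \<open>d A\<close> has the same numerical radius as \<open>A\<close>, and its square
  \<open>c A^2\<close> has real form value \<open>|<A^2 x, x>|\<close> at \<open>x\<close>. The
  bound on real parts then suffices, with \<open>r\<close> decreasing to the numerical
  radius.\<close>

lemma numerical_radius_square_le:
  assumes A: "bounded_clinear A"
  shows "numerical_radius (\<lambda>x. A (A x)) \<le> (numerical_radius A)\<^sup>2"
proof (rule numerical_radius_least)
  fix x :: 'a assume x: "norm x = 1"
  obtain c where c: "cmod c = 1"
    "c * cinner (A (A x)) x = complex_of_real (cmod (cinner (A (A x)) x))"
    using unit_phase by blast
  define d where "d = csqrt c"
  have d: "d * d = c" "cmod d = 1"
    using c(1) by (simp_all add: d_def flip: power2_eq_square)
  let ?D = "\<lambda>x. d *\<^sub>C A x"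
  have D: "bounded_clinear ?D"
    by (rule bounded_clinear_scaleC[OF A])
  have wD: "numerical_radius ?D = numerical_radius A"
    by (simp add: numerical_radius_def cinner_scaleC_left norm_mult d)
  have "?D (?D x) = c *\<^sub>C A (A x)"
    by (simp add: bounded_clinearD(5)[OF A] scaleC_scaleC d)
  then have eq: "Re (cinner (?D (?D x)) x) = cmod (cinner (A (A x)) x)"
    by (simp add: cinner_scaleC_left c)
  have "cmod (cinner (A (A x)) x) \<le> r\<^sup>2" if "numerical_radius A < r" for r
    using Re_cinner_square_le[OF D, of r x] that x by (simp add: wD eq)
  then have "sqrt (cmod (cinner (A (A x)) x)) \<le> r" if "numerical_radius A < r" for r
    using that numerical_radius_nonneg[OF A] by (simp add: real_le_lsqrt)
  then have "sqrt (cmod (cinner (A (A x)) x)) \<le> numerical_radius A"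
    by (rule dense_ge)
  then show "cmod (cinner (A (A x)) x) \<le> (numerical_radius A)\<^sup>2"
    by (rule sqrt_le_D)
qed simp

section \<open>Bounds for the Euclidean operator radius\<close>

lemma euclidean_radius_bounds:
  assumes "bounded_clinear B" "bounded_clinear C"
  shows "0 \<le> euclidean_radius B C"
    and "norm x = 1 \<Longrightarrow>
      (cmod (cinner (B x) x))\<^sup>2 + (cmod (cinner (C x) x))\<^sup>2 \<le> (euclidean_radius B C)\<^sup>2"
proof -
  let ?f = "\<lambda>x. sqrt ((cmod (cinner (B x) x))\<^sup>2 + (cmod (cinner (C x) x))\<^sup>2)"
  have bound: "?f x \<le> sqrt ((numerical_radius B)\<^sup>2 + (numerical_radius C)\<^sup>2)" if "norm x = 1" for x
    using that by (intro real_sqrt_le_mono add_mono power_mono numerical_radius_unit assms) auto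
  show "0 \<le> euclidean_radius B C"
    unfolding euclidean_radius_def by (rule sup_unit_nonneg[OF bound]) auto
  show "(cmod (cinner (B x) x))\<^sup>2 + (cmod (cinner (C x) x))\<^sup>2 \<le> (euclidean_radius B C)\<^sup>2"
    if "norm x = 1"
    using sup_unit_upper[where f = ?f, OF bound that]
    unfolding euclidean_radius_def by (rule sqrt_le_D)
qed

lemma euclidean_radius_square_least:
  assumes "bounded_clinear B" "bounded_clinear C" "0 \<le> M"
    and "\<And>x. norm x = 1 \<Longrightarrow> (cmod (cinner (B x) x))\<^sup>2 + (cmod (cinner (C x) x))\<^sup>2 \<le> M"
  shows "(euclidean_radius B C)\<^sup>2 \<le> M"
proof -
  have "euclidean_radius B C \<le> sqrt M"
    unfolding euclidean_radius_def using assms(3,4) by (intro sup_unit_least) auto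
  then have "(euclidean_radius B C)\<^sup>2 \<le> (sqrt M)\<^sup>2"
    using euclidean_radius_bounds(1)[OF assms(1,2)] by (rule power_mono)
  then show ?thesis
    using assms(3) by simp
qed

lemma numerical_radius_square_le_euclidean:
  assumes B: "bounded_clinear B" and C: "bounded_clinear C"
  shows "(numerical_radius (\<lambda>x. B x + C x))\<^sup>2 \<le> 2 * (euclidean_radius B C)\<^sup>2"
    and "(numerical_radius (\<lambda>x. B x - C x))\<^sup>2 \<le> 2 * (euclidean_radius B C)\<^sup>2"
proof -
  let ?e = "euclidean_radius B C"
  have e: "0 \<le> sqrt 2 * ?e"
    using euclidean_radius_bounds(1)[OF B C] by simp
  have sum: "cmod (cinner (B x) x) + cmod (cinner (C x) x) \<le> sqrt 2 * ?e" if "norm x = 1" for x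
  proof (rule power2_le_imp_le)
    have "(cmod (cinner (B x) x) + cmod (cinner (C x) x))\<^sup>2
        \<le> 2 * ((cmod (cinner (B x) x))\<^sup>2 + (cmod (cinner (C x) x))\<^sup>2)"
      using zero_le_power2[of "cmod (cinner (B x) x) - cmod (cinner (C x) x)"]
      by (simp add: power2_sum power2_diff)
    also have "\<dots> \<le> (sqrt 2 * ?e)\<^sup>2"
      using euclidean_radius_bounds(2)[OF B C that] by (simp add: power_mult_distrib)
    finally show "(cmod (cinner (B x) x) + cmod (cinner (C x) x))\<^sup>2 \<le> (sqrt 2 * ?e)\<^sup>2" .
  qed (rule e)
  have "numerical_radius (\<lambda>x. B x + C x) \<le> sqrt 2 * ?e"
  proof (rule numerical_radius_least[OF _ e])
    show "cmod (cinner (B x + C x) x) \<le> sqrt 2 * ?e" if "norm x = 1" for x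
      unfolding cinner_add_left by (rule order_trans[OF norm_triangle_ineq sum[OF that]])
  qed
  from power_mono[OF this numerical_radius_nonneg[OF bounded_clinear_add[OF B C]], of 2]
  show "(numerical_radius (\<lambda>x. B x + C x))\<^sup>2 \<le> 2 * ?e\<^sup>2"
    by (simp add: power_mult_distrib)
  have "numerical_radius (\<lambda>x. B x - C x) \<le> sqrt 2 * ?e"
  proof (rule numerical_radius_least[OF _ e])
    show "cmod (cinner (B x - C x) x) \<le> sqrt 2 * ?e" if "norm x = 1" for x
      unfolding cinner_diff_left by (rule order_trans[OF norm_triangle_ineq4 sum[OF that]])
  qed
  from power_mono[OF this numerical_radius_nonneg[OF bounded_clinear_diff[OF B C]], of 2]
  show "(numerical_radius (\<lambda>x. B x - C x))\<^sup>2 \<le> 2 * ?e\<^sup>2"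
    by (simp add: power_mult_distrib)
qed

lemma euclidean_radius_lower_bound:
  assumes B: "bounded_clinear B" and C: "bounded_clinear C"
  shows "1/2 * numerical_radius (\<lambda>x. B (B x) + C (C x))
      + 1/2 * max (numerical_radius B) (numerical_radius C)
        * \<bar>numerical_radius (\<lambda>x. B x + C x) - numerical_radius (\<lambda>x. B x - C x)\<bar>
    \<le> (euclidean_radius B C)\<^sup>2"
proof -
  let ?S = "\<lambda>x. B x + C x" and ?D = "\<lambda>x. B x - C x"
  define p q where "p = numerical_radius ?S" and "q = numerical_radius ?D"
  define E where "E = (euclidean_radius B C)\<^sup>2"
  define m where "m = max (numerical_radius B) (numerical_radius C)"
  have S: "bounded_clinear ?S" and D: "bounded_clinear ?D"
    by (intro bounded_clinear_add bounded_clinear_diff B C)+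
  note linB = bounded_clinearD[OF B] and linC = bounded_clinearD[OF C]
  have pq: "0 \<le> p" "0 \<le> q"
    by (simp_all add: p_def q_def numerical_radius_nonneg S D)
  have unit: "cmod (cinner (?S x) x) \<le> p" "cmod (cinner (?D x) x) \<le> q" if "norm x = 1" for x
    using numerical_radius_unit[OF S that] numerical_radius_unit[OF D that]
    by (simp_all add: p_def q_def)
  \<comment> \<open>\<open>2 B\<close> and \<open>2 C\<close> are the sum and the difference of
    \<open>B + C\<close> and \<open>B - C\<close>.\<close>
  have "numerical_radius B \<le> (p + q) / 2"
  proof (rule numerical_radius_least)
    fix x :: 'a assume x: "norm x = 1"
    have "2 * cmod (cinner (B x) x) = cmod (cinner (?S x) x + cinner (?D x) x)"
      by (simp add: cinner_add_left cinner_diff_left norm_mult flip: mult_2)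
    then show "cmod (cinner (B x) x) \<le> (p + q) / 2"
      using norm_triangle_mono[OF unit[OF x]] by simp
  qed (use pq in simp)
  moreover have "numerical_radius C \<le> (p + q) / 2"
  proof (rule numerical_radius_least)
    fix x :: 'a assume x: "norm x = 1"
    have "2 * cmod (cinner (C x) x) = cmod (cinner (?S x) x - cinner (?D x) x)"
      by (simp add: cinner_add_left cinner_diff_left norm_mult flip: mult_2)
    then show "cmod (cinner (C x) x) \<le> (p + q) / 2"
      using order_trans[OF norm_triangle_ineq4 add_mono[OF unit[OF x]]] by simp
  qed (use pq in simp)
  ultimately have m: "m \<le> (p + q) / 2"
    by (simp add: m_def)
  have W: "numerical_radius (\<lambda>x. B (B x) + C (C x)) \<le> (p\<^sup>2 + q\<^sup>2) / 2"
  proof (rule numerical_radius_least)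
    fix x :: 'a assume x: "norm x = 1"
    \<comment> \<open>The mixed products \<open>B C\<close> and \<open>C B\<close> cancel
      separately, so \<open>B\<close> and \<open>C\<close> need not commute.\<close>
    have eq: "?S (?S x) + ?D (?D x) = 2 *\<^sub>R (B (B x) + C (C x))"
      by (simp add: linB(2,3) linC(2,3) scaleR_2)
    have "2 * cmod (cinner (B (B x) + C (C x)) x) = cmod (cinner (?S (?S x) + ?D (?D x)) x)"
      unfolding eq by (simp add: cinner_scaleR_left norm_mult)
    also have "\<dots> \<le> numerical_radius (\<lambda>x. ?S (?S x)) + numerical_radius (\<lambda>x. ?D (?D x))"
      unfolding cinner_add_left[of "?S (?S x)"] using x
      by (intro norm_triangle_mono numerical_radius_unit[where A = "\<lambda>x. ?S (?S x)"]
          numerical_radius_unit[where A = "\<lambda>x. ?D (?D x)"]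
          bounded_clinear_compose[OF S S] bounded_clinear_compose[OF D D])
    also have "\<dots> \<le> p\<^sup>2 + q\<^sup>2"
      unfolding p_def q_def by (intro add_mono numerical_radius_square_le S D)
    finally show "cmod (cinner (B (B x) + C (C x)) x) \<le> (p\<^sup>2 + q\<^sup>2) / 2"
      by simp
  qed simp
  have pE: "p\<^sup>2 \<le> 2 * E" and qE: "q\<^sup>2 \<le> 2 * E"
    unfolding p_def q_def E_def by (rule numerical_radius_square_le_euclidean[OF B C])+
  have "m * \<bar>p - q\<bar> \<le> (p + q) / 2 * \<bar>p - q\<bar>"
    using m by (rule mult_right_mono) simp
  moreover have "(p + q) / 2 * \<bar>p - q\<bar> = \<bar>p\<^sup>2 - q\<^sup>2\<bar> / 2"
    using pq by (simp add: abs_mult square_diff_square_factored power2_eq_square)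
  ultimately have mE: "m * \<bar>p - q\<bar> \<le> \<bar>p\<^sup>2 - q\<^sup>2\<bar> / 2"
    by simp
  \<comment> \<open>Equivalent to \<open>max (p^2) (q^2) \<le> 2 * E\<close>, because
    \<open>|p^2 - q^2| + p^2 + q^2\<close> is twice that maximum.\<close>
  have dE: "\<bar>p\<^sup>2 - q\<^sup>2\<bar> \<le> 4 * E - p\<^sup>2 - q\<^sup>2"
    using pE qE by (simp add: abs_le_iff)
  have "1/2 * ((p\<^sup>2 + q\<^sup>2) / 2) + 1/2 * (m * \<bar>p - q\<bar>) \<le> E"
    using mE dE by (simp add: field_simps)
  then have "1/2 * numerical_radius (\<lambda>x. B (B x) + C (C x)) + 1/2 * (m * \<bar>p - q\<bar>) \<le> E"
    by (rule order_trans[rotated]) (use W in simp)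
  then show ?thesis
    unfolding p_def q_def E_def m_def by (simp only: mult.assoc)
qed

lemma product_sum_Cauchy_Schwarz:
  fixes a b c d :: real
  shows "a * b + c * d \<le> sqrt (a\<^sup>2 + c\<^sup>2) * sqrt (b\<^sup>2 + d\<^sup>2)"
proof -
  \<comment> \<open>Lagrange's identity: the difference of the two sides is
    \<open>(a * d - b * c)^2\<close>.\<close>
  have "(a * b + c * d)\<^sup>2 \<le> (a\<^sup>2 + c\<^sup>2) * (b\<^sup>2 + d\<^sup>2)"
    using zero_le_power2[of "a * d - b * c"] by (simp add: power2_eq_square algebra_simps)
  then have "\<bar>a * b + c * d\<bar> \<le> sqrt ((a\<^sup>2 + c\<^sup>2) * (b\<^sup>2 + d\<^sup>2))"
    by (metis real_sqrt_abs real_sqrt_le_iff)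
  then show ?thesis
    by (simp add: real_sqrt_mult)
qed

text \<open>Arbitrary positive operators dominating the forms of \<open>B\<close> and
  \<open>C\<close> are allowed, so that both entries of the minimum are instances.\<close>

lemma euclidean_radius_upper_bound:
  assumes B: "bounded_clinear B" and C: "bounded_clinear C"
    and P: "positive_op P1" "positive_op P2" "positive_op Q1" "positive_op Q2"
    and BP: "\<And>x. (cmod (cinner (B x) x))\<^sup>2 \<le> inner (P1 x) x * inner (Q1 x) x"
    and CP: "\<And>x. (cmod (cinner (C x) x))\<^sup>2 \<le> inner (P2 x) x * inner (Q2 x) x"
  shows "(euclidean_radius B C)\<^sup>2
    \<le> numerical_radius (\<lambda>x. P1 x + \<i> *\<^sub>C P2 x) * numerical_radius (\<lambda>x. Q1 x + \<i> *\<^sub>C Q2 x)"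
proof -
  have lin: "bounded_clinear (\<lambda>x. P x + \<i> *\<^sub>C Q x)" if "positive_op P" "positive_op Q" for P Q :: "'a \<Rightarrow> 'a"
    using that by (intro bounded_clinear_add bounded_clinear_scaleC) (auto simp: positive_op_def)
  \<comment> \<open>Both forms are real, so they are the real and imaginary parts of the form of
    \<open>P + \<i> Q\<close>.\<close>
  have cm: "sqrt ((inner (P x) x)\<^sup>2 + (inner (Q x) x)\<^sup>2) \<le> numerical_radius (\<lambda>x. P x + \<i> *\<^sub>C Q x)"
    if "positive_op P" "positive_op Q" "norm x = 1" for P Q :: "'a \<Rightarrow> 'a" and x
    using numerical_radius_unit[OF lin[OF that(1,2)] that(3)]
    by (simp add: cinner_add_left cinner_scaleC_left positive_op_cinner(1)[OF that(1)]
        positive_op_cinner(1)[OF that(2)] cmod_def)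
  show ?thesis
  proof (rule euclidean_radius_square_least[OF B C])
    show "0 \<le> numerical_radius (\<lambda>x. P1 x + \<i> *\<^sub>C P2 x) * numerical_radius (\<lambda>x. Q1 x + \<i> *\<^sub>C Q2 x)"
      by (intro mult_nonneg_nonneg numerical_radius_nonneg lin P)
    fix x :: 'a assume x: "norm x = 1"
    have "(cmod (cinner (B x) x))\<^sup>2 + (cmod (cinner (C x) x))\<^sup>2
        \<le> inner (P1 x) x * inner (Q1 x) x + inner (P2 x) x * inner (Q2 x) x"
      by (intro add_mono BP CP)
    also have "\<dots> \<le> sqrt ((inner (P1 x) x)\<^sup>2 + (inner (P2 x) x)\<^sup>2)
        * sqrt ((inner (Q1 x) x)\<^sup>2 + (inner (Q2 x) x)\<^sup>2)"
      by (rule product_sum_Cauchy_Schwarz)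
    also have "\<dots> \<le> numerical_radius (\<lambda>x. P1 x + \<i> *\<^sub>C P2 x) * numerical_radius (\<lambda>x. Q1 x + \<i> *\<^sub>C Q2 x)"
      using x by (intro mult_mono cm P numerical_radius_nonneg lin) auto
    finally show "(cmod (cinner (B x) x))\<^sup>2 + (cmod (cinner (C x) x))\<^sup>2
        \<le> numerical_radius (\<lambda>x. P1 x + \<i> *\<^sub>C P2 x) * numerical_radius (\<lambda>x. Q1 x + \<i> *\<^sub>C Q2 x)" .
  qed
qed

theorem theorem2p2:
  fixes B C :: "'a::chilbert_space \<Rightarrow> 'a"
  assumes "bounded_clinear B" and "bounded_clinear C"
  shows "(1/2 * numerical_radius (\<lambda>x. B (B x) + C (C x))
        + 1/2 * max (numerical_radius B) (numerical_radius C)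
          * \<bar>numerical_radius (\<lambda>x. B x + C x) - numerical_radius (\<lambda>x. B x - C x)\<bar>
        \<le> (euclidean_radius B C)\<^sup>2) \<and>
         ((euclidean_radius B C)\<^sup>2
        \<le> min (numerical_radius (\<lambda>x. abs_op B x + \<i> *\<^sub>C abs_op C x)
               * numerical_radius (\<lambda>x. abs_op (cadjoint B) x + \<i> *\<^sub>C abs_op (cadjoint C) x))
              (numerical_radius (\<lambda>x. abs_op B x + \<i> *\<^sub>C abs_op (cadjoint C) x)
               * numerical_radius (\<lambda>x. abs_op (cadjoint B) x + \<i> *\<^sub>C abs_op C x)))"
proof (intro conjI min.boundedI)
  note pos = positive_abs_op[OF assms(1)] positive_abs_op[OF assms(2)]
    positive_abs_op[OF bounded_clinear_cadjoint[OF assms(1)]]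
    positive_abs_op[OF bounded_clinear_cadjoint[OF assms(2)]]
  note schwarz = cinner_abs_op_Schwarz[OF assms(1)] cinner_abs_op_Schwarz[OF assms(2)]
  show "1/2 * numerical_radius (\<lambda>x. B (B x) + C (C x))
        + 1/2 * max (numerical_radius B) (numerical_radius C)
          * \<bar>numerical_radius (\<lambda>x. B x + C x) - numerical_radius (\<lambda>x. B x - C x)\<bar>
      \<le> (euclidean_radius B C)\<^sup>2"
    by (rule euclidean_radius_lower_bound[OF assms])
  show "(euclidean_radius B C)\<^sup>2
      \<le> numerical_radius (\<lambda>x. abs_op B x + \<i> *\<^sub>C abs_op C x)
        * numerical_radius (\<lambda>x. abs_op (cadjoint B) x + \<i> *\<^sub>C abs_op (cadjoint C) x)"
    by (rule euclidean_radius_upper_bound[OF assms pos schwarz])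
  \<comment> \<open>The Schwarz bound for \<open>C\<close> is symmetric in \<open>abs_op C\<close>
    and \<open>abs_op (cadjoint C)\<close>; exchanging these two gives the second product.\<close>
  show "(euclidean_radius B C)\<^sup>2
      \<le> numerical_radius (\<lambda>x. abs_op B x + \<i> *\<^sub>C abs_op (cadjoint C) x)
        * numerical_radius (\<lambda>x. abs_op (cadjoint B) x + \<i> *\<^sub>C abs_op C x)"
    using schwarz(2)
    by (intro euclidean_radius_upper_bound[OF assms pos(1,4,3,2) schwarz(1)]) (simp add: mult.commute)
qed

end
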